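(* Let $n \ge 1$ and $k \ge 0$ be integers and let $p:\mathbf{F}_2^n \to \mathbf{F}_2$ be a polynomial of degree at most $2$. Let $f(x) = (-1)^{p(x)}$. Then \[ \sum_{A \subset [n],\, |A| = k} |\hat f(A)| \le (1+\sqrt{2})^k . \]
   Context: For $f:\mathbf{F}_2^n \to \mathbf{C}$ and $A \subset [n]=\{1,\dots,n\}$, the Fourier coefficient is $\hat f(A) = \frac{1}{2^n}\sum_{x \in \mathbf{F}_2^n} f(x)(-1)^{x_A}$, where $x_A = \sum_{i\in A} x_i$. The quantity $\sum_{|A|=k}|\hat f(A)|$ is called the $k$-th Fourier weight of $f$. *)

theory Defs
  imports Complex_Main "HOL-Library.Z2" "HOL-Library.FuncSet"
begin

text \<open>
  \<open>\<^bold>F\<^sub>2\<^sup>n\<close> is the set of extensional functions from \<open>{1..n}\<close> to the two-element field \<^typ>\<open>bit\<close>.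
\<close>

definition cube :: "nat \<Rightarrow> (nat \<Rightarrow> bit) set" where
  "cube n = {1..n} \<rightarrow>\<^sub>E UNIV"

definition sgn_bit :: "bit \<Rightarrow> complex" where
  "sgn_bit b = (-1) ^ (of_bit b :: nat)"

definition fourier_coeff :: "nat \<Rightarrow> ((nat \<Rightarrow> bit) \<Rightarrow> complex) \<Rightarrow> nat set \<Rightarrow> complex" where
  "fourier_coeff n f A = 1 / 2 ^ n * (\<Sum>x\<in>cube n. f x * sgn_bit (\<Sum>i\<in>A. x i))"

definition exponents :: "nat \<Rightarrow> nat \<Rightarrow> (nat \<Rightarrow> nat) set" where
  "exponents n d = {m \<in> {1..n} \<rightarrow>\<^sub>E UNIV. (\<Sum>i=1..n. m i) \<le> d}"

text \<open>
  The values of \<open>p\<close> on \<^term>\<open>cube n\<close> are those of a polynomial in \<open>n\<close> variables over \<^typ>\<open>bit\<close>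
  of total degree at most \<open>d\<close>; \<open>c m\<close> is the coefficient of the monomial with exponent
  vector \<open>m\<close>.
\<close>

definition poly_deg_le :: "nat \<Rightarrow> nat \<Rightarrow> ((nat \<Rightarrow> bit) \<Rightarrow> bit) \<Rightarrow> bool" where
  "poly_deg_le n d p \<longleftrightarrow>
     (\<exists>c. \<forall>x\<in>cube n. p x = (\<Sum>m\<in>exponents n d. c m * (\<Prod>i=1..n. x i ^ m i)))"

lemma finite_cube: "finite (cube n)"
proof -
  have "(UNIV :: bit set) = {0, 1}"
    using bit_not_zero_iff by blast
  then have "finite (UNIV :: bit set)"
    by (metis finite.emptyI finite.insertI)
  then show ?thesis
    unfolding cube_def by (intro finite_PiE) auto
qed

lemma card_cube: "card (cube n) = 2 ^ n"
proof -
  have "(UNIV :: bit set) = {0, 1}"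
    using bit_not_zero_iff by blast
  then have "card (UNIV :: bit set) = 2"
    by (metis card_2_iff zero_neq_one)
  then show ?thesis
    unfolding cube_def by (simp add: card_PiE)
qed

lemma finite_exponents: "finite (exponents n d)"
proof (rule finite_subset)
  show "exponents n d \<subseteq> {1..n} \<rightarrow>\<^sub>E {..d}"
  proof
    fix m assume m: "m \<in> exponents n d"
    have "m i \<le> d" if "i \<in> {1..n}" for i
      using member_le_sum[of i "{1..n}" m] that m by (auto simp: exponents_def)
    then show "m \<in> {1..n} \<rightarrow>\<^sub>E {..d}"
      using m by (auto simp: exponents_def PiE_iff)
  qed
qed (auto intro: finite_PiE)

end

theory Submission
  imports Defs
begin

text \<open>
  Let \<open>R\<close> be the radical of the symmetric bilinear form attached to \<open>p\<close>. Squaring the character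
  sum shows that the squared modulus of the Fourier coefficient at \<open>A\<close> equals \<open>|R| / 2\<^sup>n\<close> if \<open>A\<close> lies in an affine subspace \<open>S\<close> of
  the power set of \<open>{1..n}\<close> and vanishes elsewhere; by Parseval \<open>|S| |R| = 2\<^sup>n\<close>. An induction
  on \<open>n\<close> shows that any affine subspace \<open>S\<close> satisfies
  \<open>\<Sum>A\<in>S. t\<^bsup>|A|\<^esup> \<le> \<surd>|S|\<close> for \<open>t = \<surd>2 - 1 = 1 / (1 + \<surd>2)\<close>, so \<open>S\<close> contains at most
  \<open>(1 + \<surd>2)\<^sup>k \<surd>|S|\<close> sets of size \<open>k\<close>.
\<close>

section \<open>Sets of given size in affine families\<close>

text \<open>With \<open>sym_diff\<close> as addition over F_2, closure under sums of three elements
  characterises affine subspaces. The empty family qualifies too, so a slice of an affine family is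
  always affine.\<close>

definition affine_family :: "'a set set \<Rightarrow> bool" where
  "affine_family S \<longleftrightarrow> (\<forall>A\<in>S. \<forall>B\<in>S. \<forall>C\<in>S. sym_diff (sym_diff A B) C \<in> S)"

lemma affine_familyD:
  "affine_family S \<Longrightarrow> A \<in> S \<Longrightarrow> B \<in> S \<Longrightarrow> C \<in> S \<Longrightarrow> sym_diff (sym_diff A B) C \<in> S"
  by (auto simp: affine_family_def)

text \<open>Translation by the sum of \<open>A\<close> and \<open>B\<close> is an involution of
  \<open>S\<close>. It toggles \<open>a\<close>, since exactly one of \<open>A\<close> and
  \<open>B\<close> contains it.\<close>

lemma affine_family_halves_card:
  assumes S: "affine_family S" "finite S" and A: "A \<in> S" "a \<notin> A" and B: "B \<in> S" "a \<in> B"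
  shows "card {X\<in>S. a \<in> X} = card {X\<in>S. a \<notin> X}"
proof (rule bij_betw_same_card)
  let ?t = "\<lambda>X. sym_diff (sym_diff X A) B"
  have inv: "?t (?t X) = X" for X by auto
  have mem: "?t X \<in> S" if "X \<in> S" for X using affine_familyD[OF S(1) that A(1) B(1)] .
  show "bij_betw ?t {X\<in>S. a \<in> X} {X\<in>S. a \<notin> X}"
  proof (rule bij_betw_byWitness[where f' = ?t])
    show "\<forall>X\<in>{X\<in>S. a \<in> X}. ?t (?t X) = X" "\<forall>X\<in>{X\<in>S. a \<notin> X}. ?t (?t X) = X"
      using inv by blast+
    show "?t ` {X\<in>S. a \<in> X} \<subseteq> {X\<in>S. a \<notin> X}" "?t ` {X\<in>S. a \<notin> X} \<subseteq> {X\<in>S. a \<in> X}"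
      using mem A(2) B(2) by auto
  qed
qed

text \<open>Split \<open>S\<close> by membership of one point \<open>a\<close>: both slices are
  affine over the smaller ground set, and the slice through \<open>a\<close> carries an extra factor
  \<open>sqrt 2 - 1\<close>.\<close>

lemma affine_family_weight_sum_le:
  fixes S :: "'a set set"
  assumes "finite U" "S \<subseteq> Pow U" "affine_family S"
  shows "(\<Sum>A\<in>S. (sqrt 2 - 1) ^ card A) \<le> sqrt (card S)"
  using assms
proof (induction U arbitrary: S rule: finite_induct)
  case empty
  then have "S = {} \<or> S = {{}}" by auto
  then show ?case by auto
next
  case (insert a U)
  let ?t = "sqrt 2 - 1 :: real"
  have t: "0 \<le> ?t" "?t \<le> 1" using real_sqrt_le_mono[of 2 4] by auto
  have finS: "finite S" using insert.prems(1) insert.hyps(1) by (meson finite.insertI finite_Pow_iff finite_subset)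
  define S0 where "S0 = {A\<in>S. a \<notin> A}"
  define T where "T = {A\<in>S. a \<in> A}"
  define S1 where "S1 = (\<lambda>A. A - {a}) ` T"
  have fin: "finite S0" "finite T" using finS by (auto simp: S0_def T_def)
  have S: "S = S0 \<union> T" "S0 \<inter> T = {}" by (auto simp: S0_def T_def)
  have inj: "inj_on (\<lambda>A. A - {a}) T"
    by (rule inj_onI) (auto simp: T_def)
  then have cT: "card S1 = card T" by (simp add: S1_def card_image)
  have cS: "card S = card S0 + card T" using fin S by (simp add: card_Un_disjoint)
  have aff0: "affine_family S0"
    using insert.prems(2) by (auto simp: affine_family_def S0_def)
  have aff1: "affine_family S1"
    unfolding affine_family_def
  proof (intro ballI)
    fix A' B' C' assume "A' \<in> S1" "B' \<in> S1" "C' \<in> S1"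
    then obtain A B C where T: "A \<in> T" "B \<in> T" "C \<in> T"
      and eq: "A' = A - {a}" "B' = B - {a}" "C' = C - {a}" by (auto simp: S1_def)
    have "sym_diff (sym_diff A B) C \<in> T"
      using T affine_familyD[OF insert.prems(2), of A B C] by (auto simp: T_def)
    moreover have "sym_diff (sym_diff A' B') C' = sym_diff (sym_diff A B) C - {a}"
      unfolding eq by blast
    ultimately show "sym_diff (sym_diff A' B') C' \<in> S1" unfolding S1_def by (rule image_eqI[rotated])
  qed
  have le0: "(\<Sum>A\<in>S0. ?t ^ card A) \<le> sqrt (card S0)"
    using insert.prems(1) by (intro insert.IH aff0) (auto simp: S0_def)
  have le1: "(\<Sum>A\<in>S1. ?t ^ card A) \<le> sqrt (card T)"
    unfolding cT[symmetric]
    using insert.prems(1) by (intro insert.IH aff1) (auto simp: S1_def T_def)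
  have "(\<Sum>A\<in>T. ?t ^ card A) = (\<Sum>A\<in>T. ?t * ?t ^ card (A - {a}))"
  proof (rule sum.cong[OF refl])
    fix A assume "A \<in> T"
    then have "a \<in> A" "finite A"
      using insert.prems(1) insert.hyps(1) by (auto simp: T_def intro: finite_subset)
    then have "card A = Suc (card (A - {a}))" by (simp only: card_Suc_Diff1)
    then show "?t ^ card A = ?t * ?t ^ card (A - {a})" by (simp only: power_Suc)
  qed
  also have "\<dots> = ?t * (\<Sum>A\<in>S1. ?t ^ card A)"
    unfolding S1_def sum.reindex[OF inj] by (simp add: sum_distrib_left)
  also have "\<dots> \<le> ?t * sqrt (card T)" using le1 t(1) by (rule mult_left_mono)
  finally have "(\<Sum>A\<in>S. ?t ^ card A) \<le> sqrt (card S0) + ?t * sqrt (card T)"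
    using le0 by (simp add: S sum.union_disjoint fin del: real_sqrt_le_iff)
  also have "\<dots> \<le> sqrt (card S)"
  proof (cases "S0 = {} \<or> T = {}")
    case True
    then show ?thesis using t(2) mult_right_mono[OF t(2), of "sqrt (card T)"] by (auto simp: cS)
  next
    case False
    then obtain A B where "A \<in> S" "a \<notin> A" "B \<in> S" "a \<in> B" by (auto simp: S0_def T_def)
    from affine_family_halves_card[OF insert.prems(2) finS this]
    have eq: "card T = card S0" by (simp add: S0_def T_def)
    \<comment> \<open>Two slices of equal size are the tight case: \<open>1 + ?t = sqrt 2\<close> is
      exactly the growth of \<open>sqrt (card S)\<close> when the family doubles.\<close>
    have "sqrt (card S0) + ?t * sqrt (card T) = sqrt 2 * sqrt (card S0)"
      by (simp add: eq algebra_simps)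
    also have "\<dots> = sqrt (card S)" by (simp add: cS eq flip: real_sqrt_mult)
    finally show ?thesis by simp
  qed
  finally show ?case .
qed

text \<open>A Markov-type bound: each set of size \<open>k\<close> contributes
  \<open>(sqrt 2 - 1) ^ k\<close> to the weighted sum, and \<open>1 + sqrt 2\<close> is the inverse
  of \<open>sqrt 2 - 1\<close>.\<close>

lemma affine_family_card_le:
  assumes "finite U" "S \<subseteq> Pow U" "affine_family S"
  shows "card {A\<in>S. card A = k} \<le> (1 + sqrt 2) ^ k * sqrt (card S)"
proof -
  let ?t = "sqrt 2 - 1 :: real"
  have finS: "finite S" using assms(1,2) by (meson finite_Pow_iff finite_subset)
  have inv: "(1 + sqrt 2) * ?t = 1" by (simp add: algebra_simps)
  have "?t ^ k * card {A\<in>S. card A = k} = (\<Sum>A | A \<in> S \<and> card A = k. ?t ^ card A)" by simp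
  also have "\<dots> \<le> (\<Sum>A\<in>S. ?t ^ card A)" by (rule sum_mono2) (use finS in auto)
  also have "\<dots> \<le> sqrt (card S)" by (rule affine_family_weight_sum_le[OF assms])
  finally have "(1 + sqrt 2) ^ k * (?t ^ k * card {A\<in>S. card A = k}) \<le> (1 + sqrt 2) ^ k * sqrt (card S)"
    by (intro mult_left_mono) auto
  then show ?thesis by (simp add: inv flip: mult.assoc power_mult_distrib)
qed

section \<open>Signs and the group structure of the cube\<close>

text \<open>The default simpset turns arithmetic on \<^typ>\<open>bit\<close> into bit operations, which blocks ring normalisation.\<close>

declare add_bit_eq_xor [simp del] mult_bit_eq_and [simp del] power_bit_unfold [simp del]
  One_nat_def [simp del]

text \<open>A real-valued copy of \<open>sgn_bit\<close>, so that character sums can be squared and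
  compared in the reals.\<close>

definition sgr :: "bit \<Rightarrow> real" where
  "sgr b = (if b = 0 then 1 else -1)"

lemma sgn_bit_eq_sgr: "sgn_bit b = of_real (sgr b)"
  by (cases b) (auto simp: sgn_bit_def sgr_def)

lemma sgr_0 [simp]: "sgr 0 = 1" and sgr_1 [simp]: "sgr 1 = -1"
  by (auto simp: sgr_def)

lemma sgr_add: "sgr (a + b) = sgr a * sgr b"
  by (cases a; cases b) auto

lemma sgr_sum: "sgr (\<Sum>i\<in>A. x i) = (\<Prod>i\<in>A. sgr (x i))"
  by (induction A rule: infinite_finite_induct) (auto simp: sgr_add)

lemma bit_add_self [simp]: "(b::bit) + b = 0" "(b::bit) + (b + c) = c"
  by (cases b; cases c; simp)+

text \<open>Restriction to \<open>{1..n}\<close> keeps sums extensional, hence inside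
  \<open>cube n\<close>.\<close>

definition cadd :: "nat \<Rightarrow> (nat \<Rightarrow> bit) \<Rightarrow> (nat \<Rightarrow> bit) \<Rightarrow> nat \<Rightarrow> bit" where
  "cadd n x y = (\<lambda>i\<in>{1..n}. x i + y i)"

definition czero :: "nat \<Rightarrow> nat \<Rightarrow> bit" where
  "czero n = (\<lambda>i\<in>{1..n}. 0)"

lemma cadd_in_cube [simp]: "cadd n x y \<in> cube n"
  and czero_in_cube [simp]: "czero n \<in> cube n"
  by (auto simp: cadd_def czero_def cube_def)

lemma cadd_apply: "i \<in> {1..n} \<Longrightarrow> cadd n x y i = x i + y i"
  and czero_apply: "i \<in> {1..n} \<Longrightarrow> czero n i = 0"
  by (auto simp: cadd_def czero_def)

lemma cube_eqI: "x \<in> cube n \<Longrightarrow> y \<in> cube n \<Longrightarrow> (\<And>i. i \<in> {1..n} \<Longrightarrow> x i = y i) \<Longrightarrow> x = y"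
  unfolding cube_def by (rule PiE_ext)

lemma cadd_commute: "cadd n x y = cadd n y x"
  by (auto simp: cadd_def add_ac)

lemma cadd_cancel: "y \<in> cube n \<Longrightarrow> cadd n x (cadd n x y) = y"
  and cadd_czero: "x \<in> cube n \<Longrightarrow> cadd n x (czero n) = x"
  by (auto intro!: cube_eqI[where n = n] simp: cadd_apply czero_apply)

lemma sum_cadd: "A \<subseteq> {1..n} \<Longrightarrow> (\<Sum>i\<in>A. cadd n x y i) = (\<Sum>i\<in>A. x i) + (\<Sum>i\<in>A. y i)"
  unfolding sum.distrib[symmetric] by (rule sum.cong) (auto simp: cadd_apply)

lemma sum_sym_diff_bit:
  fixes x :: "'a \<Rightarrow> bit"
  assumes "finite A" "finite B"
  shows "(\<Sum>i\<in>sym_diff A B. x i) = (\<Sum>i\<in>A. x i) + (\<Sum>i\<in>B. x i)"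
proof -
  have A: "(\<Sum>i\<in>A. x i) = (\<Sum>i\<in>A - B. x i) + (\<Sum>i\<in>A \<inter> B. x i)"
    using assms by (metis add.commute sum.Int_Diff)
  have B: "(\<Sum>i\<in>B. x i) = (\<Sum>i\<in>B - A. x i) + (\<Sum>i\<in>A \<inter> B. x i)"
    using assms by (metis add.commute sum.Int_Diff inf_commute)
  have "(\<Sum>i\<in>sym_diff A B. x i) = (\<Sum>i\<in>A - B. x i) + (\<Sum>i\<in>B - A. x i)"
    using assms by (intro sum.union_disjoint) auto
  then show ?thesis unfolding A B by (simp add: add_ac)
qed

text \<open>Orthogonality: if \<open>\<phi> h = 1\<close> for some \<open>h\<close> in
  \<open>H\<close>, translation by \<open>h\<close> permutes \<open>H\<close> and flips every sign,
  so the sum equals its own negative.\<close>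

lemma character_sum:
  assumes H: "H \<subseteq> cube n" "\<And>x y. x \<in> H \<Longrightarrow> y \<in> H \<Longrightarrow> cadd n x y \<in> H"
    and \<phi>: "\<And>x y. x \<in> H \<Longrightarrow> y \<in> H \<Longrightarrow> \<phi> (cadd n x y) = \<phi> x + \<phi> y"
  shows "(\<Sum>x\<in>H. sgr (\<phi> x)) = (if \<forall>x\<in>H. \<phi> x = 0 then real (card H) else 0)"
proof (cases "\<forall>x\<in>H. \<phi> x = 0")
  case False
  then obtain h where h: "h \<in> H" "\<phi> h = 1" by (meson bit_not_zero_iff)
  have "bij_betw (cadd n h) H H"
    by (rule bij_betw_byWitness[where f' = "cadd n h"]) (use h H in \<open>auto simp: cadd_cancel\<close>)
  then have "(\<Sum>x\<in>H. sgr (\<phi> x)) = (\<Sum>x\<in>H. sgr (\<phi> (cadd n h x)))"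
    by (rule sum.reindex_bij_betw[symmetric])
  also have "\<dots> = - (\<Sum>x\<in>H. sgr (\<phi> x))"
    by (simp add: \<phi> h sgr_add sum_negf)
  finally have "(\<Sum>x\<in>H. sgr (\<phi> x)) = 0" by simp
  then show ?thesis unfolding if_not_P[OF False] .
qed simp

text \<open>The sum over all \<open>A\<close> factors into a product of terms
  \<open>sgr (x i) + 1\<close>, which vanishes as soon as one coordinate is 1.\<close>

lemma sum_sgr_Pow:
  assumes "x \<in> cube n"
  shows "(\<Sum>A\<in>Pow {1..n}. sgr (\<Sum>i\<in>A. x i)) = (if x = czero n then 2 ^ n else 0)"
proof -
  have "(\<Sum>A\<in>Pow {1..n}. sgr (\<Sum>i\<in>A. x i)) = (\<Prod>i\<in>{1..n}. sgr (x i) + 1)"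
    by (subst prod_add) (auto simp: sgr_sum)
  also have "\<dots> = (if x = czero n then 2 ^ n else 0)"
  proof (cases "x = czero n")
    case False
    then obtain i where "i \<in> {1..n}" "x i \<noteq> 0"
      using cube_eqI[OF assms czero_in_cube] by (metis czero_apply)
    then have "\<exists>i\<in>{1..n}. sgr (x i) + 1 = 0" by (auto simp: sgr_def)
    then show ?thesis using False by (simp add: prod_zero)
  qed (simp add: czero_apply)
  finally show ?thesis .
qed

section \<open>Quadratic functions\<close>

text \<open>Degree at most two, expressed as the vanishing of the third derivative.\<close>

definition quadratic :: "nat \<Rightarrow> ((nat \<Rightarrow> bit) \<Rightarrow> bit) \<Rightarrow> bool" where
  "quadratic n p \<longleftrightarrow> (\<forall>x\<in>cube n. \<forall>y\<in>cube n. \<forall>z\<in>cube n.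
     p (cadd n (cadd n x y) z) =
       p (cadd n x y) + p (cadd n x z) + p (cadd n y z) + p x + p y + p z + p (czero n))"

lemma quadratic_cong: "(\<And>x. x \<in> cube n \<Longrightarrow> p x = q x) \<Longrightarrow> quadratic n q \<Longrightarrow> quadratic n p"
  by (auto simp: quadratic_def)

lemma quadratic_sum:
  assumes "\<And>j. j \<in> J \<Longrightarrow> quadratic n (q j)"
  shows "quadratic n (\<lambda>x. \<Sum>j\<in>J. q j x)"
  unfolding quadratic_def sum.distrib[symmetric]
  using assms by (auto simp: quadratic_def intro!: sum.cong)

lemma quadratic_cmult: "quadratic n p \<Longrightarrow> quadratic n (\<lambda>x. c * p x)"
  by (auto simp: quadratic_def algebra_simps)

text \<open>Listing the variables with multiplicity turns a degree bound into a length bound, so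
  that degree at most two leaves three shapes to check.\<close>

lemma monomial_eq_prod_list:
  assumes "finite I"
  shows "\<exists>l. set l \<subseteq> I \<and> length l = (\<Sum>i\<in>I. m i) \<and>
    (\<forall>x :: 'a \<Rightarrow> bit. (\<Prod>i\<in>I. x i ^ m i) = prod_list (map x l))"
  using assms
proof (induction I)
  case (insert a I)
  then obtain l where l: "set l \<subseteq> I" "length l = (\<Sum>i\<in>I. m i)"
    "\<And>x :: 'a \<Rightarrow> bit. (\<Prod>i\<in>I. x i ^ m i) = prod_list (map x l)" by blast
  show ?case
    by (rule exI[of _ "replicate (m a) a @ l"])
      (use insert.hyps l in auto)
qed simp

lemma quadratic_monomial:
  assumes "m \<in> exponents n 2"
  shows "quadratic n (\<lambda>x. \<Prod>i=1..n. x i ^ m i)"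
proof -
  obtain l where l: "set l \<subseteq> {1..n}" "length l = (\<Sum>i=1..n. m i)"
    "\<And>x :: nat \<Rightarrow> bit. (\<Prod>i=1..n. x i ^ m i) = prod_list (map x l)"
    using monomial_eq_prod_list[of "{1..n}" m] by auto
  have "length l \<le> 2" using assms l(2) by (simp add: exponents_def)
  \<comment> \<open>\<open>remdups_adj.cases\<close> serves only as a split into lists of length 0,
    1 and at least 2.\<close>
  then consider "l = []" | a where "l = [a]" | a b where "l = [a, b]"
    by (cases l rule: remdups_adj.cases) auto
  then show ?thesis
  proof cases
    case 1
    then show ?thesis unfolding l(3) by (simp add: quadratic_def)
  next
    case (2 a)
    then show ?thesis using l(1) unfolding l(3)
      by (simp add: quadratic_def cadd_apply czero_apply add_ac)
  next
    case (3 a b)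
    then show ?thesis using l(1) unfolding l(3)
      by (simp add: quadratic_def cadd_apply czero_apply algebra_simps)
  qed
qed

lemma poly_deg_le_2_quadratic:
  assumes "poly_deg_le n 2 p"
  shows "quadratic n p"
proof -
  obtain c where "\<And>x. x \<in> cube n \<Longrightarrow> p x = (\<Sum>m\<in>exponents n 2. c m * (\<Prod>i=1..n. x i ^ m i))"
    using assms by (auto simp: poly_deg_le_def)
  then show ?thesis
    by (rule quadratic_cong) (assumption | intro quadratic_sum quadratic_cmult quadratic_monomial)+
qed

section \<open>The polar form and its radical\<close>

definition polar :: "nat \<Rightarrow> ((nat \<Rightarrow> bit) \<Rightarrow> bit) \<Rightarrow> (nat \<Rightarrow> bit) \<Rightarrow> (nat \<Rightarrow> bit) \<Rightarrow> bit" where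
  "polar n p x y = p (cadd n x y) + p x + p y + p (czero n)"

definition radical :: "nat \<Rightarrow> ((nat \<Rightarrow> bit) \<Rightarrow> bit) \<Rightarrow> (nat \<Rightarrow> bit) set" where
  "radical n p = {y\<in>cube n. \<forall>x\<in>cube n. polar n p x y = 0}"

lemma radical_subset_cube: "radical n p \<subseteq> cube n"
  by (auto simp: radical_def)

lemma polar_commute: "polar n p x y = polar n p y x"
  by (simp add: polar_def cadd_commute add_ac)

text \<open>This is the vanishing of the third derivative, rearranged: in characteristic two the
  repeated terms cancel.\<close>

lemma polar_add_left:
  assumes "quadratic n p" "x \<in> cube n" "y \<in> cube n" "z \<in> cube n"
  shows "polar n p (cadd n x y) z = polar n p x z + polar n p y z"
proof -
  have "p (cadd n (cadd n x y) z) =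
       p (cadd n x y) + p (cadd n x z) + p (cadd n y z) + p x + p y + p z + p (czero n)"
    using assms by (auto simp: quadratic_def)
  then show ?thesis by (simp add: polar_def add_ac)
qed

lemma cadd_in_radical:
  assumes "quadratic n p" "x \<in> radical n p" "y \<in> radical n p"
  shows "cadd n x y \<in> radical n p"
proof -
  have "polar n p z (cadd n x y) = 0" if "z \<in> cube n" for z
  proof -
    have "polar n p (cadd n x y) z = polar n p z x + polar n p z y"
      using assms that by (simp add: polar_add_left radical_def polar_commute[of n p z])
    then show ?thesis using assms that by (simp add: radical_def polar_commute[of n p z "cadd n x y"])
  qed
  then show ?thesis by (simp add: radical_def)
qed

lemma czero_in_radical: "czero n \<in> radical n p"
  by (auto simp: radical_def polar_def cadd_czero add_ac)

section \<open>Walsh sums: their squares and their support\<close>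

definition walsh_sum :: "nat \<Rightarrow> ((nat \<Rightarrow> bit) \<Rightarrow> bit) \<Rightarrow> nat set \<Rightarrow> real" where
  "walsh_sum n p A = (\<Sum>x\<in>cube n. sgr (p x + (\<Sum>i\<in>A. x i)))"

text \<open>Expand the square and substitute \<open>cadd n x y\<close> for the second variable. The
  only remaining dependence on \<open>x\<close> is the character \<open>sgr (polar n p x y)\<close>,
  whose sum over the cube is \<open>2 ^ n\<close> for \<open>y\<close> in the radical and 0
  otherwise.\<close>

lemma walsh_sum_square:
  assumes q: "quadratic n p" and A: "A \<subseteq> {1..n}"
  shows "(walsh_sum n p A)\<^sup>2 = 2 ^ n * (\<Sum>y\<in>radical n p. sgr (p y + p (czero n) + (\<Sum>i\<in>A. y i)))"
proof -
  let ?g = "\<lambda>x. p x + (\<Sum>i\<in>A. x i)"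
  let ?h = "\<lambda>y. sgr (p y + p (czero n) + (\<Sum>i\<in>A. y i))"
  have "(walsh_sum n p A)\<^sup>2 = (\<Sum>x\<in>cube n. \<Sum>y\<in>cube n. sgr (?g x) * sgr (?g y))"
    by (simp add: walsh_sum_def power2_eq_square sum_product)
  also have "\<dots> = (\<Sum>x\<in>cube n. \<Sum>y\<in>cube n. sgr (?g x) * sgr (?g (cadd n x y)))"
  proof (rule sum.cong[OF refl])
    fix x
    have "bij_betw (cadd n x) (cube n) (cube n)"
      by (rule bij_betw_byWitness[where f' = "cadd n x"]) (auto simp: cadd_cancel)
    then show "(\<Sum>y\<in>cube n. sgr (?g x) * sgr (?g y))
        = (\<Sum>y\<in>cube n. sgr (?g x) * sgr (?g (cadd n x y)))"
      by (rule sum.reindex_bij_betw[symmetric])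
  qed
  also have "\<dots> = (\<Sum>x\<in>cube n. \<Sum>y\<in>cube n. ?h y * sgr (polar n p x y))"
    by (intro sum.cong refl) (simp add: sum_cadd[OF A] polar_def add_ac flip: sgr_add)
  also have "\<dots> = (\<Sum>y\<in>cube n. ?h y * (\<Sum>x\<in>cube n. sgr (polar n p x y)))"
    by (subst sum.swap) (simp add: sum_distrib_left)
  also have "\<dots> = (\<Sum>y\<in>cube n. if y \<in> radical n p then 2 ^ n * ?h y else 0)"
  proof (rule sum.cong[OF refl])
    fix y assume y: "y \<in> cube n"
    have "(\<Sum>x\<in>cube n. sgr (polar n p x y)) = (if y \<in> radical n p then 2 ^ n else 0)"
      by (subst character_sum[where n = n]) (use y q in \<open>auto simp: polar_add_left card_cube radical_def\<close>)
    then show "?h y * (\<Sum>x\<in>cube n. sgr (polar n p x y)) = (if y \<in> radical n p then 2 ^ n * ?h y else 0)"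
      by simp
  qed
  also have "\<dots> = (\<Sum>y\<in>radical n p. 2 ^ n * ?h y)"
    by (rule sum.mono_neutral_cong_right) (auto simp: finite_cube radical_def)
  finally show ?thesis by (simp add: sum_distrib_left)
qed

text \<open>After summing the formula for the square over all \<open>A\<close>, only the zero vector
  of the radical survives, contributing \<open>2 ^ n * 2 ^ n\<close>.\<close>

lemma walsh_parseval:
  assumes q: "quadratic n p"
  shows "(\<Sum>A\<in>Pow {1..n}. (walsh_sum n p A)\<^sup>2) = 4 ^ n"
proof -
  let ?c = "\<lambda>y. sgr (p y + p (czero n))"
  have fin: "finite (radical n p)" by (simp add: radical_def finite_cube)
  have "(\<Sum>A\<in>Pow {1..n}. (walsh_sum n p A)\<^sup>2)
      = (\<Sum>A\<in>Pow {1..n}. \<Sum>y\<in>radical n p. 2 ^ n * (?c y * sgr (\<Sum>i\<in>A. y i)))"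
    by (intro sum.cong refl) (simp add: walsh_sum_square[OF q] sgr_add sum_distrib_left)
  also have "\<dots> = (\<Sum>y\<in>radical n p. 2 ^ n * (?c y * (\<Sum>A\<in>Pow {1..n}. sgr (\<Sum>i\<in>A. y i))))"
    by (subst sum.swap) (simp add: sum_distrib_left)
  also have "\<dots> = (\<Sum>y\<in>radical n p. if y = czero n then 4 ^ n else 0)"
    by (intro sum.cong refl)
      (auto simp: sum_sgr_Pow radical_def simp flip: power_mult_distrib)
  also have "\<dots> = 4 ^ n" using fin czero_in_radical by (simp add: sum.delta)
  finally show ?thesis .
qed

text \<open>An inhomogeneous linear system for the indicator vector of \<open>A\<close>, with one
  equation for each \<open>y\<close> in the radical.\<close>

definition walsh_support :: "nat \<Rightarrow> ((nat \<Rightarrow> bit) \<Rightarrow> bit) \<Rightarrow> nat set set" where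
  "walsh_support n p =
    {A. A \<subseteq> {1..n} \<and> (\<forall>y\<in>radical n p. p y + p (czero n) + (\<Sum>i\<in>A. y i) = 0)}"

lemma walsh_sum_square_eq:
  assumes q: "quadratic n p" and A: "A \<subseteq> {1..n}"
  shows "(walsh_sum n p A)\<^sup>2 = (if A \<in> walsh_support n p then 2 ^ n * card (radical n p) else 0)"
proof -
  \<comment> \<open>The polar form vanishes on the radical, so \<open>p y + p (czero n)\<close> is
    additive there and \<open>character_sum\<close> applies.\<close>
  have add: "p (cadd n x y) = p x + p y + p (czero n)"
    if "x \<in> radical n p" "y \<in> radical n p" for x y
  proof -
    have "polar n p x y = 0" using that by (auto simp: radical_def)
    moreover have "p (cadd n x y) = p x + p y + p (czero n) + polar n p x y"
      by (simp add: polar_def add_ac)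
    ultimately show ?thesis by simp
  qed
  have "(\<Sum>y\<in>radical n p. sgr (p y + p (czero n) + (\<Sum>i\<in>A. y i)))
    = (if A \<in> walsh_support n p then real (card (radical n p)) else 0)"
    by (subst character_sum[where n = n])
      (use A in \<open>auto simp: radical_subset_cube add sum_cadd add_ac walsh_support_def cadd_in_radical[OF q]\<close>)
  then show ?thesis by (simp add: walsh_sum_square[OF q A])
qed

text \<open>Adding three equations for the same \<open>y\<close> leaves the inhomogeneous term
  \<open>p y + p (czero n)\<close> once, as two of its three copies cancel.\<close>

lemma affine_family_walsh_support: "affine_family (walsh_support n p)"
  unfolding affine_family_def
proof (intro ballI)
  fix A B C assume S: "A \<in> walsh_support n p" "B \<in> walsh_support n p" "C \<in> walsh_support n p"
  then have sub: "A \<subseteq> {1..n}" "B \<subseteq> {1..n}" "C \<subseteq> {1..n}" by (auto simp: walsh_support_def)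
  then have fin: "finite A" "finite B" "finite C" by (auto intro: finite_subset)
  show "sym_diff (sym_diff A B) C \<in> walsh_support n p"
    unfolding walsh_support_def
  proof (intro CollectI conjI ballI)
    show "sym_diff (sym_diff A B) C \<subseteq> {1..n}" using sub by blast
    fix y assume "y \<in> radical n p"
    then have "p y + p (czero n) + (\<Sum>i\<in>A. y i) = 0" "p y + p (czero n) + (\<Sum>i\<in>B. y i) = 0"
      "p y + p (czero n) + (\<Sum>i\<in>C. y i) = 0"
      using S by (auto simp: walsh_support_def)
    moreover have "(\<Sum>i\<in>sym_diff (sym_diff A B) C. y i) = (\<Sum>i\<in>A. y i) + (\<Sum>i\<in>B. y i) + (\<Sum>i\<in>C. y i)"
      using fin by (simp add: sum_sym_diff_bit)
    ultimately show "p y + p (czero n) + (\<Sum>i\<in>sym_diff (sym_diff A B) C. y i) = 0"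
      by (metis add.assoc add.right_neutral bit_add_self(2))
  qed
qed

section \<open>From Walsh sums to the Fourier weight\<close>

lemma norm_fourier_coeff_eq:
  assumes "\<And>x. x \<in> cube n \<Longrightarrow> f x = sgn_bit (p x)"
  shows "norm (fourier_coeff n f A) = \<bar>walsh_sum n p A\<bar> / 2 ^ n"
proof -
  have "fourier_coeff n f A = of_real (walsh_sum n p A / 2 ^ n)"
    using assms by (simp add: fourier_coeff_def walsh_sum_def sgn_bit_eq_sgr sgr_add)
  then show ?thesis by (simp only: norm_of_real) simp
qed

theorem theorem1p1:
  fixes n k :: nat and p :: "(nat \<Rightarrow> bit) \<Rightarrow> bit" and f :: "(nat \<Rightarrow> bit) \<Rightarrow> complex"
  assumes "n \<ge> 1"
    and "poly_deg_le n 2 p"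
    and "\<And>x. x \<in> cube n \<Longrightarrow> f x = sgn_bit (p x)"
  shows "(\<Sum>A | A \<subseteq> {1..n} \<and> card A = k. norm (fourier_coeff n f A)) \<le> (1 + sqrt 2) ^ k"
proof -
  have q: "quadratic n p" using assms(2) by (rule poly_deg_le_2_quadratic)
  let ?S = "walsh_support n p"
  \<comment> \<open>The common modulus of all Walsh sums on the support.\<close>
  define c where "c = sqrt (2 ^ n * card (radical n p))"
  have c0: "c \<ge> 0" by (simp add: c_def)
  have S: "?S \<subseteq> Pow {1..n}" by (auto simp: walsh_support_def)
  have abs: "\<bar>walsh_sum n p A\<bar> = (if A \<in> ?S then c else 0)" if "A \<subseteq> {1..n}" for A
    using walsh_sum_square_eq[OF q that] by (simp add: c_def flip: real_sqrt_abs)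
  have "4 ^ n = (\<Sum>A\<in>Pow {1..n}. if A \<in> ?S then c\<^sup>2 else 0)"
    unfolding walsh_parseval[OF q, symmetric]
    by (rule sum.cong) (auto simp: walsh_sum_square_eq[OF q] c_def)
  also have "\<dots> = (\<Sum>A\<in>?S. c\<^sup>2)"
    by (rule sum.mono_neutral_cong_right) (use S in auto)
  finally have "c\<^sup>2 * card ?S = 4 ^ n" by simp
  then have "sqrt (c\<^sup>2 * card ?S) = sqrt ((2 ^ n)\<^sup>2)" by (simp add: power2_eq_square flip: power_mult_distrib)
  \<comment> \<open>Parseval in the form needed at the end: the factor \<open>sqrt (card ?S)\<close>
    from the counting bound cancels against the normalisation \<open>c / 2 ^ n\<close>.\<close>
  then have cS: "c * sqrt (card ?S) = 2 ^ n" using c0 by (simp add: real_sqrt_mult)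
  have "(\<Sum>A | A \<subseteq> {1..n} \<and> card A = k. norm (fourier_coeff n f A))
      = (\<Sum>A | A \<subseteq> {1..n} \<and> card A = k. if A \<in> ?S then c / 2 ^ n else 0)"
    by (rule sum.cong) (auto simp: norm_fourier_coeff_eq[OF assms(3)] abs)
  also have "\<dots> = (\<Sum>A | A \<in> ?S \<and> card A = k. c / 2 ^ n)"
    by (rule sum.mono_neutral_cong_right) (use S in auto)
  also have "\<dots> = c / 2 ^ n * card {A\<in>?S. card A = k}" by simp
  also have "\<dots> \<le> c / 2 ^ n * ((1 + sqrt 2) ^ k * sqrt (card ?S))"
    using affine_family_card_le[OF _ S affine_family_walsh_support, of k] c0
    by (intro mult_left_mono) auto
  also have "\<dots> = (1 + sqrt 2) ^ k * (c * sqrt (card ?S)) / 2 ^ n" by simp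
  also have "\<dots> = (1 + sqrt 2) ^ k" by (simp add: cS)
  finally show ?thesis .
qed

end
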